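(* Let $s$ be any clique size. In the dynamic network model described in the context, restricted to topology changes that are node insertions (together with the new node's incident edges), node deletions, or edge deletions, the deterministic $1$-round bandwidth complexity of $\mathsf{List}(K_s)$ is $O(1)$. That is, there is a deterministic algorithm in which, in every round, each node sends each neighbor a message of $O(1)$ bits, and after the single round of communication following each topology change every $s$-clique of the current graph is listed by at least one of its nodes and no node lists a set of $s$ nodes that is not an $s$-clique of the current graph.
   Context: Dynamic network model: the network is a sequence of graphs $(G_0, G_1, \dots, G_r)$. All nodes of the initial graph $G_0$ know its complete topology. Each $G_i$ is either identical to $G_{i-1}$ or differs from it by a single topology change of an allowed type: edge insertion, edge deletion, node insertion (together with all its incident edges), or node deletion (together with all its incident edges). Each node has a unique ID of $O(\log n)$ bits, where $n$ is the current number of nodes, and knows the IDs of its current neighbors. Communication is synchronous. Each round consists of: (1) the topology change occurs, and each node learns its new neighbor list (a node can compare it with its previous neighbor list, but cannot distinguish the insertion of edge $\{u,v\}$ from the insertion of node $v$); (2) each node sends to each of its current neighbors a message of at most $B$ bits (messages to different neighbors may differ), where $B$ is the bandwidth; (3) nodes receive messages and output their lists. A deleted node sends nothing and lists nothing. $K_s$ denotes the clique on $s$ vertices. For a graph $H$, the problem $\mathsf{List}(H)$ requires that in each round, every subgraph of the current graph $G_i$ isomorphic to $H$ be listed (i.e., the IDs of all its nodes output) by at least one of its nodes, and that every listed set be a subgraph of $G_i$ isomorphic to $H$. The deterministic $1$-round bandwidth complexity of a problem is the minimum bandwidth $B$ for which there is a deterministic algorithm whose output at every node is correct after one round of communication following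 each topology change. *)

theory Defs
  imports Complex_Main "HOL-Library.Log_Nat"
begin

text \<open>A node is identified with its ID, a natural number.\<close>

record graph =
  verts :: "nat set"
  edges :: "nat set set"

definition wf_graph :: "graph \<Rightarrow> bool" where
  "wf_graph G \<longleftrightarrow> finite (verts G) \<and> edges G \<subseteq> {e. e \<subseteq> verts G \<and> card e = 2}"

definition nbrs :: "graph \<Rightarrow> nat \<Rightarrow> nat set" where
  "nbrs G v = {u. {v, u} \<in> edges G}"

definition subgraph :: "graph \<Rightarrow> graph \<Rightarrow> bool" where
  "subgraph K G \<longleftrightarrow> wf_graph K \<and> verts K \<subseteq> verts G \<and> edges K \<subseteq> edges G"

definition isomorphic :: "graph \<Rightarrow> graph \<Rightarrow> bool" where
  "isomorphic H K \<longleftrightarrow> (\<exists>f. bij_betw f (verts H) (verts K) \<and> edges K = (\<lambda>e. f ` e) ` edges H)"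

definition complete_graph :: "nat \<Rightarrow> graph" where
  "complete_graph s = \<lparr>verts = {..<s}, edges = {e. e \<subseteq> {..<s} \<and> card e = 2}\<rparr>"

datatype change = Edge_Insertion | Edge_Deletion | Node_Insertion | Node_Deletion

fun change_step :: "change \<Rightarrow> graph \<Rightarrow> graph \<Rightarrow> bool" where
  "change_step Edge_Insertion G G' \<longleftrightarrow>
     (\<exists>u\<in>verts G. \<exists>v\<in>verts G. u \<noteq> v \<and> {u, v} \<notin> edges G \<and>
        G' = \<lparr>verts = verts G, edges = insert {u, v} (edges G)\<rparr>)"
| "change_step Edge_Deletion G G' \<longleftrightarrow>
     (\<exists>e\<in>edges G. G' = \<lparr>verts = verts G, edges = edges G - {e}\<rparr>)"
| "change_step Node_Insertion G G' \<longleftrightarrow>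
     (\<exists>v N. v \<notin> verts G \<and> N \<subseteq> verts G \<and>
        G' = \<lparr>verts = insert v (verts G), edges = edges G \<union> {{v, u} |u. u \<in> N}\<rparr>)"
| "change_step Node_Deletion G G' \<longleftrightarrow>
     (\<exists>v\<in>verts G. G' = \<lparr>verts = verts G - {v}, edges = {e \<in> edges G. v \<notin> e}\<rparr>)"

text \<open>IDs have \<open>O(log n)\<close> bits, where \<open>c\<close> is the hidden constant. Here \<open>floorlog 2 k\<close> is the
  length of the binary representation of \<open>k\<close>; using the length of \<open>n\<close> in place of \<open>log n\<close>
  avoids the degenerate case \<open>n = 1\<close>.\<close>

definition short_ids :: "nat \<Rightarrow> graph \<Rightarrow> bool" where
  "short_ids c G \<longleftrightarrow> (\<forall>v\<in>verts G. floorlog 2 v \<le> c * floorlog 2 (card (verts G)))"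

text \<open>\<open>G 0, \<dots>, G r\<close> is a dynamic network whose topology changes are of the types in \<open>T\<close>;
  the values of \<open>G\<close> beyond \<open>r\<close> are irrelevant.\<close>

definition dynamic_network :: "nat \<Rightarrow> change set \<Rightarrow> nat \<Rightarrow> (nat \<Rightarrow> graph) \<Rightarrow> bool" where
  "dynamic_network c T r G \<longleftrightarrow>
     wf_graph (G 0) \<and>
     (\<forall>i\<le>r. short_ids c (G i)) \<and>
     (\<forall>i<r. G (Suc i) = G i \<or> (\<exists>t\<in>T. change_step t (G i) (G (Suc i))))"

text \<open>What a node does is an arbitrary function of everything it has seen
  so far: its ID, the initial graph if it belonged to it, and, for each round since it joined, its
  neighbor list and the messages received, indexed by the sender. A joining node is told neither the
  round number nor anything about the graph besides its neighbor list.\<close>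

datatype origin = Initial graph | Inserted

record view =
  ident :: nat
  origin :: origin
  history :: "(nat set \<times> (nat \<rightharpoonup> bool list)) list"

text \<open>\<open>send A \<rho> N u\<close> is the message sent to the neighbor \<open>u\<close> by a node whose view before the round
  is \<open>\<rho>\<close> and whose new neighbor list is \<open>N\<close>. The output depends on the view after the round.\<close>

record algorithm =
  send :: "view \<Rightarrow> nat set \<Rightarrow> nat \<Rightarrow> bool list"
  outputs :: "view \<Rightarrow> nat set set"

definition pre_view :: "(nat \<Rightarrow> view) \<Rightarrow> graph \<Rightarrow> nat \<Rightarrow> view" where
  "pre_view \<sigma> G v =
     (if v \<in> verts G then \<sigma> v else \<lparr>ident = v, origin = Inserted, history = []\<rparr>)"

definition round_messages ::
    "algorithm \<Rightarrow> (nat \<Rightarrow> view) \<Rightarrow> graph \<Rightarrow> nat \<Rightarrow> nat \<Rightarrow> bool list" where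
  "round_messages A \<rho> G u v = send A (\<rho> u) (nbrs G u) v"

text \<open>\<open>views A G i v\<close> is the view of \<open>v\<close> at the end of round \<open>i\<close>; it is meaningful only for
  \<open>v \<in> verts (G i)\<close>. In particular, an ID that is deleted and later inserted again starts afresh.\<close>

primrec views :: "algorithm \<Rightarrow> (nat \<Rightarrow> graph) \<Rightarrow> nat \<Rightarrow> nat \<Rightarrow> view" where
  "views A G 0 = (\<lambda>v. \<lparr>ident = v, origin = Initial (G 0), history = []\<rparr>)"
| "views A G (Suc i) =
     (let \<rho> = pre_view (views A G i) (G i); G' = G (Suc i) in
       (\<lambda>v. \<rho> v\<lparr>history := history (\<rho> v) @
          [(nbrs G' v, \<lambda>u. if u \<in> nbrs G' v then Some (round_messages A \<rho> G' u v) else None)]\<rparr>))"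

definition message :: "algorithm \<Rightarrow> (nat \<Rightarrow> graph) \<Rightarrow> nat \<Rightarrow> nat \<Rightarrow> nat \<Rightarrow> bool list" where
  "message A G i u v = round_messages A (pre_view (views A G i) (G i)) (G (Suc i)) u v"

definition listed :: "algorithm \<Rightarrow> (nat \<Rightarrow> graph) \<Rightarrow> nat \<Rightarrow> nat \<Rightarrow> nat set set" where
  "listed A G i v = (if v \<in> verts (G i) then outputs A (views A G i v) else {})"

type_synonym problem = "graph \<Rightarrow> (nat \<Rightarrow> nat set set) \<Rightarrow> bool"

definition List_problem :: "graph \<Rightarrow> problem" where
  "List_problem H G L \<longleftrightarrow>
     (\<forall>K. subgraph K G \<and> isomorphic H K \<longrightarrow> (\<exists>v\<in>verts K. verts K \<in> L v)) \<and>
     (\<forall>v. \<forall>S\<in>L v. \<exists>K. subgraph K G \<and> isomorphic H K \<and> verts K = S)"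

text \<open>The deterministic 1-round bandwidth complexity of \<open>P\<close> is at most \<open>B\<close>, where \<open>B\<close> is a function
  of the current number of nodes. \<open>message A G i\<close> belongs to round \<open>Suc i\<close>.\<close>

definition one_round_bandwidth_at_most ::
    "nat \<Rightarrow> change set \<Rightarrow> problem \<Rightarrow> (nat \<Rightarrow> nat) \<Rightarrow> bool" where
  "one_round_bandwidth_at_most c T P B \<longleftrightarrow>
     (\<exists>A. \<forall>r G. dynamic_network c T r G \<longrightarrow>
        (\<forall>i<r.
          (\<forall>u\<in>verts (G (Suc i)). \<forall>v\<in>nbrs (G (Suc i)) u.
             length (message A G i u v) \<le> B (card (verts (G (Suc i))))) \<and>
          P (G (Suc i)) (listed A G (Suc i))))"

end

theory Submission
  imports Defs
begin

text \<open>Each node maintains the edges between its neighbors that it is able to see being created,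
  namely those of which at least one endpoint is not older than itself. Hence the oldest node of a
  clique knows all of its edges and can list it.

  Three flags per message keep this knowledge exact: whether the sender gained a neighbor, whether
  it lost one, and whether it lost one that it knows to be adjacent to the recipient. Two adjacent
  nodes that gain a neighbor in the same round gain the same one. The third flag distinguishes the
  deletion of an edge \<open>{u, v}\<close> from that of a common neighbor of \<open>u\<close> and \<open>v\<close>: if \<open>w\<close> is adjacent to
  both, then the older one of \<open>u\<close> and \<open>v\<close> knows the edge between \<open>w\<close> and the other, whereas a node
  that loses no neighbor never receives this flag after a node deletion.\<close>

section \<open>The algorithm: flags and their evaluation\<close>

type_synonym knowledge = "nat set \<times> nat set set"

definition flags :: "knowledge \<Rightarrow> nat set \<Rightarrow> nat \<Rightarrow> bool list" where
  "flags k N w =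
     [N - fst k \<noteq> {}, fst k - N \<noteq> {}, \<exists>x\<in>fst k - N. {w, x} \<in> snd k]"

definition raised :: "nat \<Rightarrow> (nat \<rightharpoonup> bool list) \<Rightarrow> nat set" where
  "raised j m = {u. \<exists>bs. m u = Some bs \<and> bs ! j}"

text \<open>The negated condition recognizes the deletion of the edge \<open>e\<close> itself, seen
  by a common neighbor of its ends. In the last set \<open>v\<close> is the node just inserted. A
  joining node starts with \<open>N\<close> empty, so it records no edge in its first round.\<close>

definition learn :: "knowledge \<Rightarrow> nat set \<times> (nat \<rightharpoonup> bool list) \<Rightarrow> knowledge" where
  "learn k h =
     (let N = fst k; N' = fst h; m = snd h in
      (N',
       {e \<in> snd k. e \<subseteq> N' \<and> \<not> (N \<subseteq> N' \<and> raised 2 m \<noteq> {} \<and> e \<subseteq> raised 1 m)}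
       \<union> {{u, v} |u v. u \<in> N \<inter> raised 0 m \<and> v \<in> N' - N}))"

definition initial_knowledge :: "nat \<Rightarrow> origin \<Rightarrow> knowledge" where
  "initial_knowledge v orig =
     (case orig of
        Initial G \<Rightarrow> (nbrs G v, {e \<in> edges G. e \<subseteq> nbrs G v})
      | Inserted \<Rightarrow> ({}, {}))"

definition knowledge_of :: "view \<Rightarrow> knowledge" where
  "knowledge_of \<rho> = foldl learn (initial_knowledge (ident \<rho>) (origin \<rho>)) (history \<rho>)"

definition clique_outputs :: "nat \<Rightarrow> view \<Rightarrow> nat set set" where
  "clique_outputs s \<rho> =
     {S. card S = s \<and> ident \<rho> \<in> S \<and> S - {ident \<rho>} \<subseteq> fst (knowledge_of \<rho>) \<and>
         {e. e \<subseteq> S - {ident \<rho>} \<and> card e = 2} \<subseteq> snd (knowledge_of \<rho>)}"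

definition clique_algorithm :: "nat \<Rightarrow> algorithm" where
  "clique_algorithm s =
     \<lparr>send = (\<lambda>\<rho> N u. flags (knowledge_of \<rho>) N u), outputs = clique_outputs s\<rparr>"

section \<open>Node ages and the invariant\<close>

text \<open>Membership is tested in the preceding graph, as in \<open>pre_view\<close>, so an ID
  that returns after a deletion counts as a new, youngest node.\<close>

primrec birth :: "(nat \<Rightarrow> graph) \<Rightarrow> nat \<Rightarrow> nat \<Rightarrow> nat" where
  "birth G 0 = (\<lambda>v. 0)"
| "birth G (Suc i) = (\<lambda>v. if v \<in> verts (G i) then birth G i v else Suc i)"

text \<open>The invariant: with \<open>b\<close> the births, the edge component held by
  \<open>w\<close> is exactly this set. Nodes of the initial graph have birth 0 and so know every
  edge among their neighbors.\<close>

definition known :: "(nat \<Rightarrow> nat) \<Rightarrow> graph \<Rightarrow> nat \<Rightarrow> nat set set" where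
  "known b G w = {e \<in> edges G. e \<subseteq> nbrs G w \<and> (\<exists>x\<in>e. b w \<le> b x)}"

lemma birth_le: "birth G i v \<le> i"
  by (induction i arbitrary: v) (auto simp: le_SucI)

section \<open>Well-formedness along the network\<close>

lemma wf_graph_edgeD:
  assumes "wf_graph G" "e \<in> edges G"
  obtains u v where "e = {u, v}" "u \<noteq> v" "u \<in> verts G" "v \<in> verts G"
  using assms unfolding wf_graph_def by (auto simp: card_2_iff)

lemma wf_graph_nbrsD:
  assumes "wf_graph G" "u \<in> nbrs G v"
  shows "u \<noteq> v" "u \<in> verts G" "v \<in> verts G"
  using assms unfolding wf_graph_def nbrs_def by (auto simp: card_2_iff doubleton_eq_iff)

lemma wf_graph_change_step:
  assumes "wf_graph G" "change_step t G G'"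
  shows "wf_graph G'"
proof (cases t)
  case Node_Insertion
  with assms(2) obtain v N where v: "v \<notin> verts G" "N \<subseteq> verts G"
    "G' = \<lparr>verts = insert v (verts G), edges = edges G \<union> {{v, u} |u. u \<in> N}\<rparr>" by auto
  have "card {v, u} = 2" if "u \<in> N" for u
    using v that by (cases "v = u") auto
  with v assms(1) show ?thesis unfolding wf_graph_def by auto
qed (use assms in \<open>auto simp: wf_graph_def subset_iff\<close>)

lemma wf_graph_dynamic_network:
  assumes "dynamic_network c T r G" "i \<le> r"
  shows "wf_graph (G i)"
  using assms(2)
proof (induction i)
  case (Suc i)
  then have "G (Suc i) = G i \<or> (\<exists>t\<in>T. change_step t (G i) (G (Suc i)))"
    using assms(1) unfolding dynamic_network_def by auto
  with Suc show ?case using wf_graph_change_step by auto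
qed (use assms in \<open>simp add: dynamic_network_def\<close>)

section \<open>One round under each kind of change\<close>

text \<open>The messages reaching \<open>w\<close> if every sender's knowledge is exact. This
  separates the analysis of one round from the views.\<close>

definition received :: "(nat \<Rightarrow> nat) \<Rightarrow> graph \<Rightarrow> graph \<Rightarrow> nat \<Rightarrow> nat \<rightharpoonup> bool list" where
  "received b G G' w =
     (\<lambda>u. if u \<in> nbrs G' w then Some (flags (nbrs G u, known b G u) (nbrs G' u) w) else None)"

lemma raised_received:
  "raised 0 (received b G G' w) = {u \<in> nbrs G' w. \<not> nbrs G' u \<subseteq> nbrs G u}"
  "raised 1 (received b G G' w) = {u \<in> nbrs G' w. \<not> nbrs G u \<subseteq> nbrs G' u}"
  "raised 2 (received b G G' w) =
     {u \<in> nbrs G' w. \<exists>x\<in>nbrs G u - nbrs G' u. {w, x} \<in> known b G u}"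
  by (auto simp: raised_def received_def flags_def numeral_2_eq_2)

lemma snd_learn_received:
  "snd (learn (nbrs G w, known b G w) (nbrs G' w, received b G G' w)) =
     {e \<in> known b G w. e \<subseteq> nbrs G' w \<and>
        \<not> (nbrs G w \<subseteq> nbrs G' w \<and>
           (\<exists>u\<in>nbrs G' w. \<exists>x\<in>nbrs G u - nbrs G' u. {w, x} \<in> known b G u) \<and>
           (\<forall>u\<in>e. \<not> nbrs G u \<subseteq> nbrs G' u))}
     \<union> {{u, v} |u v. u \<in> nbrs G w \<inter> nbrs G' w \<and> \<not> nbrs G' u \<subseteq> nbrs G u \<and>
          v \<in> nbrs G' w - nbrs G w}"
  unfolding learn_def Let_def fst_conv snd_conv raised_received by blast

lemma learn_unchanged:
  "snd (learn (nbrs G w, known b G w) (nbrs G w, received b G G w)) = known b G w"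
  unfolding snd_learn_received by (auto simp: known_def)

text \<open>The ends of the deleted edge are the only nodes that lose a neighbor, so no other edge
  can have flag 1 raised at both ends. It remains to see that flag 2 reaches a third node whenever
  it knew the edge.\<close>

lemma learn_edge_deletion:
  assumes "wf_graph G" "change_step Edge_Deletion G G'"
  shows "snd (learn (nbrs G w, known b G w) (nbrs G' w, received b G G' w)) = known b G' w"
proof -
  obtain d where d: "d \<in> edges G" "G' = \<lparr>verts = verts G, edges = edges G - {d}\<rparr>"
    using assms(2) by auto
  obtain p q where pq: "d = {p, q}" "p \<noteq> q"
    using wf_graph_edgeD[OF assms(1) d(1)] by metis
  have nbrs': "nbrs G' x = nbrs G x - {y. {x, y} = {p, q}}" for x
    unfolding nbrs_def d pq by auto
  have edges': "edges G' = edges G - {{p, q}}"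
    using d pq by simp
  have adj: "q \<in> nbrs G p" "p \<in> nbrs G q"
    using d pq by (auto simp: nbrs_def insert_commute)
  have lost: "\<not> nbrs G x \<subseteq> nbrs G' x \<longleftrightarrow> x \<in> {p, q}" for x
    using adj by (auto simp: nbrs' doubleton_eq_iff)
  have no_gain: "nbrs G' x - nbrs G x = {}" for x
    by (auto simp: nbrs')
  have detected: "\<exists>u\<in>nbrs G' w. \<exists>x\<in>nbrs G u - nbrs G' u. {w, x} \<in> known b G u"
    if "p \<in> nbrs G w" "q \<in> nbrs G w" "w \<notin> {p, q}"
  proof -
    have mem: "{w, y} \<in> known b G x" if "x \<in> nbrs G w" "y \<in> nbrs G w" "y \<in> nbrs G x" "b x \<le> b y" for x y
      using that by (auto simp: known_def nbrs_def insert_commute)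
    have "p \<in> nbrs G' w" "q \<in> nbrs G' w" "q \<in> nbrs G p - nbrs G' p" "p \<in> nbrs G q - nbrs G' q"
      using that adj by (auto simp: nbrs' doubleton_eq_iff insert_commute)
    then show ?thesis
      using mem[of p q] mem[of q p] that adj nat_le_linear[of "b p" "b q"] by blast
  qed
  have two: "e = {p, q}" if "e \<in> edges G" "\<forall>x\<in>e. x \<in> {p, q}" for e
  proof -
    obtain x y where "e = {x, y}" "x \<noteq> y" using wf_graph_edgeD[OF assms(1) \<open>e \<in> edges G\<close>] by metis
    with that show ?thesis by auto
  qed
  show ?thesis
  proof (cases "w \<in> {p, q}")
    \<comment> \<open>Here \<open>w\<close> itself loses a neighbor, which switches the flag rule
      off. Nothing is missed: \<open>w\<close> is not its own neighbor, so it never knew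
      \<open>{p, q}\<close>.\<close>
    case True
    then have "\<not> nbrs G w \<subseteq> nbrs G' w" by (simp only: lost)
    moreover have "{p, q} \<notin> known b G w \<and> \<not> {p, q} \<subseteq> nbrs G' w"
      using True assms(1) wf_graph_nbrsD(1) by (auto simp: known_def nbrs')
    ultimately show ?thesis
      unfolding snd_learn_received no_gain edges' by (auto simp: known_def edges' nbrs')
  next
    case False
    then have eq: "nbrs G' w = nbrs G w" by (auto simp: nbrs' doubleton_eq_iff)
    have "{p, q} \<in> known b G w \<Longrightarrow> p \<in> nbrs G w \<and> q \<in> nbrs G w"
      by (auto simp: known_def)
    \<comment> \<open>If \<open>{p, q}\<close> is unknown to \<open>w\<close>, nothing has to be
      removed, so detection is required only when both ends are neighbors of
      \<open>w\<close>.\<close>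
    with detected False have det: "{p, q} \<in> known b G w \<Longrightarrow>
        \<exists>u\<in>nbrs G' w. \<exists>x\<in>nbrs G u - nbrs G' u. {w, x} \<in> known b G u"
      by blast
    have known': "known b G' w = known b G w - {{p, q}}"
      unfolding known_def eq edges' by auto
    have sub: "\<And>e. e \<in> known b G w \<Longrightarrow> e \<subseteq> nbrs G w \<and> e \<in> edges G"
      by (auto simp: known_def)
    show ?thesis
      unfolding snd_learn_received no_gain lost known' using det two sub eq by blast
  qed
qed

text \<open>Edges at the deleted node leave through the neighbor list. The danger is a
  \<open>w\<close> that loses no neighbor but sees an edge whose ends both lose one: both raise flag
  1, as if their own edge had been deleted, and only the absence of flag 2 saves it.\<close>

lemma learn_node_deletion:
  assumes "wf_graph G" "change_step Node_Deletion G G'" "w \<in> verts G'"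
  shows "snd (learn (nbrs G w, known b G w) (nbrs G' w, received b G G' w)) = known b G' w"
proof -
  obtain z where z: "z \<in> verts G" "G' = \<lparr>verts = verts G - {z}, edges = {e \<in> edges G. z \<notin> e}\<rparr>"
    using assms(2) by auto
  have nbrs': "nbrs G' x = nbrs G x - {z}" if "x \<noteq> z" for x
    using that z by (auto simp: nbrs_def)
  have edges': "edges G' = {e \<in> edges G. z \<notin> e}"
    using z by simp
  have w: "w \<noteq> z" using assms z by auto
  \<comment> \<open>A sender of flag 2 must have lost \<open>z\<close> and know the edge
    \<open>{w, z}\<close>; but then \<open>w\<close> loses \<open>z\<close> too.\<close>
  have no_alarm: "\<not> (nbrs G w \<subseteq> nbrs G' w \<and>
      (\<exists>u\<in>nbrs G' w. \<exists>x\<in>nbrs G u - nbrs G' u. {w, x} \<in> known b G u))"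
  proof
    assume *: "nbrs G w \<subseteq> nbrs G' w \<and>
      (\<exists>u\<in>nbrs G' w. \<exists>x\<in>nbrs G u - nbrs G' u. {w, x} \<in> known b G u)"
    then obtain u x where ux: "u \<in> nbrs G' w" "x \<in> nbrs G u - nbrs G' u" "{w, x} \<in> known b G u"
      by blast
    have "u \<noteq> z" using ux(1) w by (auto simp: nbrs')
    with ux have "x = z" by (auto simp: nbrs')
    with ux have "z \<in> nbrs G w" by (auto simp: known_def nbrs_def)
    with * w show False by (auto simp: nbrs')
  qed
  show ?thesis
    unfolding snd_learn_received using no_alarm w by (auto simp: known_def edges' nbrs')
qed

text \<open>The new node is strictly younger than all others. So its edges meet the age condition
  for every older observer, while no edge among its own neighbors meets it for the new node.\<close>

lemma learn_node_insertion:
  assumes wf: "wf_graph G" and step: "change_step Node_Insertion G G'" and w: "w \<in> verts G'"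
    and t: "\<And>v. v \<in> verts G \<Longrightarrow> b v < t"
  shows "snd (learn (nbrs G w, known b G w) (nbrs G' w, received b G G' w)) =
    known (\<lambda>v. if v \<in> verts G then b v else t) G' w"
proof -
  obtain z M where z: "z \<notin> verts G" "M \<subseteq> verts G"
    "G' = \<lparr>verts = insert z (verts G), edges = edges G \<union> {{z, u} |u. u \<in> M}\<rparr>"
    using step by auto
  have old: "x \<in> verts G" "y \<in> verts G" if "y \<in> nbrs G x" for x y
    using wf_graph_nbrsD[OF wf that] by auto
  have zM: "z \<notin> M" using z by auto
  have nbrs': "nbrs G' x = (if x = z then M else if x \<in> M then insert z (nbrs G x) else nbrs G x)"
    for x
    using z zM old[of z] old[of _ z] by (auto simp: nbrs_def doubleton_eq_iff)
  have edges': "edges G' = edges G \<union> {{z, u} |u. u \<in> M}"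
    using z by simp
  have old_edge: "e \<subseteq> verts G" if "e \<in> edges G" for e
    using wf that by (auto simp: wf_graph_def)
  have z_nbr: "z \<notin> nbrs G x" "nbrs G z = {}" for x
    using old z by blast+
  let ?b = "\<lambda>v. if v \<in> verts G then b v else t"
  show ?thesis
  proof (cases "w = z")
    case True
    \<comment> \<open>Before the round \<open>z\<close> is outside \<open>G\<close> with empty
      knowledge: the update has nothing to keep and no old neighbor to learn from.\<close>
    have known_z: "known b G z = {}"
      using old_edge z wf by (auto simp: known_def z_nbr wf_graph_def)
    have "known ?b G' w = {}"
    proof -
      have False if "e \<in> known ?b G' w" for e
      proof -
        from that have "e \<subseteq> M" by (auto simp: known_def nbrs' True)
        with z have "e \<subseteq> verts G" by blast
        with that t z show False by (fastforce simp: known_def True)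
      qed
      then show ?thesis by blast
    qed
    then show ?thesis
      unfolding snd_learn_received using \<open>known ?b G' w = {}\<close> by (simp add: True z_nbr known_z)
  next
    case False
    then have wG: "w \<in> verts G" using w z by simp
    have no_loss: "nbrs G x - nbrs G' x = {}" for x
      using z_nbr by (auto simp: nbrs')
    have gain: "\<not> nbrs G' u \<subseteq> nbrs G u \<longleftrightarrow> u \<in> M" if "u \<noteq> z" for u
      using z_nbr that by (auto simp: nbrs')
    \<comment> \<open>Nobody loses a neighbor, so nothing is discarded; the pairs added are the new
      edges \<open>{u, z}\<close> of which \<open>w\<close> sees both ends.\<close>
    have "snd (learn (nbrs G w, known b G w) (nbrs G' w, received b G G' w)) =
      known b G w \<union> {{u, z} |u. u \<in> nbrs G w \<and> u \<in> M \<and> w \<in> M}"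
    proof -
      have mono: "nbrs G w \<subseteq> nbrs G' w" using no_loss by blast
      have new: "nbrs G' w - nbrs G w = (if w \<in> M then {z} else {})"
        using False z_nbr by (auto simp: nbrs')
      have "u \<in> nbrs G w \<inter> nbrs G' w \<and> \<not> nbrs G' u \<subseteq> nbrs G u \<and> v \<in> nbrs G' w - nbrs G w \<longleftrightarrow>
          v = z \<and> u \<in> nbrs G w \<and> u \<in> M \<and> w \<in> M" for u v
        unfolding new using gain[of u] z_nbr(1)[of w] mono by auto
      then have "{{u, v} |u v. u \<in> nbrs G w \<inter> nbrs G' w \<and> \<not> nbrs G' u \<subseteq> nbrs G u \<and>
            v \<in> nbrs G' w - nbrs G w} =
          {{u, z} |u. u \<in> nbrs G w \<and> u \<in> M \<and> w \<in> M}"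
        by presburger
      moreover have "{e \<in> known b G w. e \<subseteq> nbrs G' w} = known b G w"
        using mono by (auto simp: known_def)
      ultimately show ?thesis
        unfolding snd_learn_received no_loss by simp
    qed
    also have "\<dots> = known ?b G' w"
    proof (intro equalityI subsetI)
      fix e assume "e \<in> known b G w \<union> {{u, z} |u. u \<in> nbrs G w \<and> u \<in> M \<and> w \<in> M}"
      then show "e \<in> known ?b G' w"
      proof
        assume e: "e \<in> known b G w"
        then have "e \<subseteq> verts G" using old_edge by (auto simp: known_def)
        with e wG False show ?thesis by (fastforce simp: known_def edges' nbrs')
      next
        assume "e \<in> {{u, z} |u. u \<in> nbrs G w \<and> u \<in> M \<and> w \<in> M}"
        then show ?thesis
          using wG False z(1) t[of w] by (auto simp: known_def edges' nbrs')
      qed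
    next
      fix e assume e: "e \<in> known ?b G' w"
      then consider "e \<in> edges G" | u where "e = {z, u}" "u \<in> M"
        by (auto simp: known_def edges')
      then show "e \<in> known b G w \<union> {{u, z} |u. u \<in> nbrs G w \<and> u \<in> M \<and> w \<in> M}"
      proof cases
        \<comment> \<open>An old edge avoids \<open>z\<close>, so neither its place among the
          neighbors of \<open>w\<close> nor the ages of its ends have changed.\<close>
        case 1
        then have "e \<subseteq> verts G" by (rule old_edge)
        moreover then have "z \<notin> e" using z by blast
        ultimately have "e \<subseteq> nbrs G w" "\<exists>x\<in>e. b w \<le> b x"
          using e wG False by (auto simp: known_def nbrs' split: if_splits)
        with 1 show ?thesis by (simp add: known_def)
      next
        case 2
        then have "u \<noteq> z" using zM by auto
        with 2 e False z_nbr have "w \<in> M" "u \<in> nbrs G w"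
          by (auto simp: known_def nbrs' split: if_splits)
        with 2 show ?thesis by blast
      qed
    qed
    finally show ?thesis .
  qed
qed

lemma known_cong:
  assumes "wf_graph G" "w \<in> verts G" "\<And>v. v \<in> verts G \<Longrightarrow> b v = b' v"
  shows "known b G w = known b' G w"
proof -
  have "e \<in> edges G \<Longrightarrow> x \<in> e \<Longrightarrow> x \<in> verts G" for e x
    using assms(1) by (auto simp: wf_graph_def)
  then show ?thesis unfolding known_def using assms by auto
qed

text \<open>Exact knowledge stays exact through any allowed round. Without an insertion no present
  node receives the birth \<open>t\<close>, and \<open>known_cong\<close> removes the update of the
  ages.\<close>

lemma learn_change_step:
  assumes wf: "wf_graph G" and w: "w \<in> verts G'"
    and step: "G' = G \<or> (\<exists>t\<in>{Node_Insertion, Node_Deletion, Edge_Deletion}. change_step t G G')"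
    and t: "\<And>v. v \<in> verts G \<Longrightarrow> b v < t"
  shows "learn (nbrs G w, known b G w) (nbrs G' w, received b G G' w) =
    (nbrs G' w, known (\<lambda>v. if v \<in> verts G then b v else t) G' w)"
proof -
  let ?b = "\<lambda>v. if v \<in> verts G then b v else t"
  have wf': "wf_graph G'" using step wf wf_graph_change_step by blast
  have eq: "known b G' w = known ?b G' w" if "verts G' \<subseteq> verts G"
    using that by (intro known_cong[OF wf' w]) auto
  have "snd (learn (nbrs G w, known b G w) (nbrs G' w, received b G G' w)) = known ?b G' w"
  proof -
    consider "G' = G" | "change_step Node_Insertion G G'" | "change_step Node_Deletion G G'"
      | "change_step Edge_Deletion G G'"
      using step by auto
    then show ?thesis
    proof cases
      case 1
      then show ?thesis using learn_unchanged[of G w b] eq by simp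
    next
      case 2
      then show ?thesis by (rule learn_node_insertion[OF wf _ w]) (rule t)
    next
      case 3
      then have "verts G' \<subseteq> verts G" by auto
      then show ?thesis using learn_node_deletion[OF wf 3 w] eq by simp
    next
      case 4
      then have "verts G' \<subseteq> verts G" by auto
      then show ?thesis using learn_edge_deletion[OF wf 4] eq by simp
    qed
  qed
  moreover have "fst (learn (nbrs G w, known b G w) (nbrs G' w, received b G G' w)) = nbrs G' w"
    by (simp add: learn_def Let_def)
  ultimately show ?thesis by (simp add: prod_eq_iff)
qed

section \<open>Knowledge through all rounds\<close>

lemma ident_views: "ident (views A G i v) = v"
  by (induction i arbitrary: v) (auto simp: Let_def pre_view_def)

text \<open>Extends the invariant to IDs outside the graph, where both components are empty: a
  joining node already sends flags in its first round.\<close>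

lemma knowledge_of_pre_view:
  assumes "wf_graph G"
    and "v \<in> verts G \<Longrightarrow> knowledge_of (\<sigma> v) = (nbrs G v, known b G v)"
  shows "knowledge_of (pre_view \<sigma> G v) = (nbrs G v, known b G v)"
proof (cases "v \<in> verts G")
  case False
  then have "nbrs G v = {}" using wf_graph_nbrsD[OF assms(1)] by blast
  with False show ?thesis
    by (auto simp: pre_view_def knowledge_of_def initial_knowledge_def known_def)
qed (use assms in \<open>simp add: pre_view_def\<close>)

text \<open>Induction over rounds: messages are computed from the preceding knowledge, which is
  exact, so they are those of \<open>received\<close> and \<open>learn_change_step\<close>
  applies.\<close>

lemma knowledge_of_views:
  assumes dyn: "dynamic_network c {Node_Insertion, Node_Deletion, Edge_Deletion} r G"
    and "i \<le> r" "v \<in> verts (G i)"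
  shows "knowledge_of (views (clique_algorithm s) G i v) =
    (nbrs (G i) v, known (birth G i) (G i) v)"
  using assms(2-)
proof (induction i arbitrary: v)
  case 0
  \<comment> \<open>All births are 0 here, so the age condition only asks \<open>e\<close> to have
    an element.\<close>
  have "e \<noteq> {}" if "e \<in> edges (G 0)" for e
    using dyn that by (auto simp: dynamic_network_def wf_graph_def)
  then show ?case by (auto simp: knowledge_of_def initial_knowledge_def known_def)
next
  case (Suc i)
  let ?A = "clique_algorithm s"
  let ?\<rho> = "pre_view (views ?A G i) (G i)"
  let ?h = "\<lambda>v. (nbrs (G (Suc i)) v, \<lambda>u. if u \<in> nbrs (G (Suc i)) v
    then Some (round_messages ?A ?\<rho> (G (Suc i)) u v) else None)"
  have wf: "wf_graph (G i)" using wf_graph_dynamic_network[OF dyn] Suc.prems by simp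
  have pre: "knowledge_of (?\<rho> u) = (nbrs (G i) u, known (birth G i) (G i) u)" for u
    using Suc by (intro knowledge_of_pre_view[OF wf]) simp
  then have msgs: "?h v = (nbrs (G (Suc i)) v, received (birth G i) (G i) (G (Suc i)) v)"
    by (auto simp: received_def round_messages_def clique_algorithm_def)
  have "knowledge_of (views ?A G (Suc i) v) = learn (knowledge_of (?\<rho> v)) (?h v)"
    by (simp add: knowledge_of_def Let_def)
  also have "\<dots> = (nbrs (G (Suc i)) v,
      known (\<lambda>v. if v \<in> verts (G i) then birth G i v else Suc i) (G (Suc i)) v)"
    unfolding msgs pre
  proof (rule learn_change_step[OF wf Suc.prems(2)])
    show "G (Suc i) = G i \<or> (\<exists>t\<in>{Node_Insertion, Node_Deletion, Edge_Deletion}.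
        change_step t (G i) (G (Suc i)))"
      using dyn Suc.prems(1) unfolding dynamic_network_def by auto
  \<comment> \<open>Here \<open>t\<close> is \<open>Suc i\<close>, later than every birth up to
    round \<open>i\<close>.\<close>
  qed (simp add: birth_le less_Suc_eq_le)
  finally show ?case by simp
qed

section \<open>Cliques as vertex sets\<close>

lemma bij_betw_image_pairs:
  assumes "bij_betw f A B"
  shows "(\<lambda>e. f ` e) ` {e. e \<subseteq> A \<and> card e = 2} = {e. e \<subseteq> B \<and> card e = 2}"
proof -
  have inj: "inj_on f A" and im: "f ` A = B" using assms by (auto simp: bij_betw_def)
  have card: "card (f ` e) = card e" if "e \<subseteq> A" for e
    using inj that by (meson card_image inj_on_subset)
  show ?thesis
  proof (intro equalityI subsetI)
    fix e assume e: "e \<in> {e. e \<subseteq> B \<and> card e = 2}"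
    then obtain d where "d \<subseteq> A" "e = f ` d" using im by (auto simp: subset_image_iff)
    with e card show "e \<in> (\<lambda>e. f ` e) ` {e. e \<subseteq> A \<and> card e = 2}" by auto
  qed (use im card in auto)
qed

text \<open>A bijection carries all pairs to all pairs, so every enumeration of a finite clique is
  an isomorphism.\<close>

lemma isomorphic_complete_graph_iff:
  assumes "finite (verts K)"
  shows "isomorphic (complete_graph s) K \<longleftrightarrow>
    card (verts K) = s \<and> edges K = {e. e \<subseteq> verts K \<and> card e = 2}"
proof
  assume "isomorphic (complete_graph s) K"
  then obtain f where f: "bij_betw f {..<s} (verts K)"
      "edges K = (\<lambda>e. f ` e) ` {e. e \<subseteq> {..<s} \<and> card e = 2}"
    by (auto simp: isomorphic_def complete_graph_def)
  with bij_betw_same_card[OF f(1)] bij_betw_image_pairs[OF f(1)]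
  show "card (verts K) = s \<and> edges K = {e. e \<subseteq> verts K \<and> card e = 2}" by simp
next
  assume K: "card (verts K) = s \<and> edges K = {e. e \<subseteq> verts K \<and> card e = 2}"
  then obtain f where f: "bij_betw f {..<s} (verts K)"
    using assms finite_same_card_bij[of "{..<s}" "verts K"] by auto
  have "bij_betw f (verts (complete_graph s)) (verts K)"
    "edges K = (\<lambda>e. f ` e) ` edges (complete_graph s)"
    using f K bij_betw_image_pairs[OF f] by (simp_all add: complete_graph_def)
  then show "isomorphic (complete_graph s) K"
    unfolding isomorphic_def by blast
qed

text \<open>A copy of \<open>complete_graph s\<close> is determined by its vertex set, which reduces
  the problem to completeness and soundness for vertex sets.\<close>

lemma List_problem_complete_graphI:
  assumes "\<And>S. S \<subseteq> verts G \<Longrightarrow> finite S \<Longrightarrow> card S = s \<Longrightarrow>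
      {e. e \<subseteq> S \<and> card e = 2} \<subseteq> edges G \<Longrightarrow> \<exists>v\<in>S. S \<in> L v"
    and "\<And>v S. S \<in> L v \<Longrightarrow> S \<subseteq> verts G \<and> finite S \<and> card S = s \<and>
      {e. e \<subseteq> S \<and> card e = 2} \<subseteq> edges G"
  shows "List_problem (complete_graph s) G L"
  unfolding List_problem_def
proof (intro conjI allI impI ballI)
  fix K assume K: "subgraph K G \<and> isomorphic (complete_graph s) K"
  then have fin: "finite (verts K)" by (simp add: subgraph_def wf_graph_def)
  with K show "\<exists>v\<in>verts K. verts K \<in> L v"
    by (intro assms(1)) (auto simp: subgraph_def isomorphic_complete_graph_iff)
next
  fix v S assume "S \<in> L v"
  note S = assms(2)[OF this]
  let ?K = "\<lparr>verts = S, edges = {e. e \<subseteq> S \<and> card e = 2}\<rparr>"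
  have "subgraph ?K G" "isomorphic (complete_graph s) ?K"
    using S by (auto simp: subgraph_def wf_graph_def isomorphic_complete_graph_iff)
  then show "\<exists>K. subgraph K G \<and> isomorphic (complete_graph s) K \<and> verts K = S" by force
qed

section \<open>Correctness and bandwidth\<close>

lemma clique_algorithm_correct:
  assumes dyn: "dynamic_network c {Node_Insertion, Node_Deletion, Edge_Deletion} r G"
    and "i \<le> r" "s \<ge> 1"
  shows "List_problem (complete_graph s) (G i) (listed (clique_algorithm s) G i)"
proof (rule List_problem_complete_graphI)
  let ?b = "birth G i"
  have wf: "wf_graph (G i)" by (rule wf_graph_dynamic_network[OF dyn \<open>i \<le> r\<close>])
  have listed: "listed (clique_algorithm s) G i v =
      {S. card S = s \<and> v \<in> S \<and> S - {v} \<subseteq> nbrs (G i) v \<and>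
          {e. e \<subseteq> S - {v} \<and> card e = 2} \<subseteq> known ?b (G i) v}"
    if "v \<in> verts (G i)" for v
    using that knowledge_of_views[OF dyn \<open>i \<le> r\<close> that]
    by (simp add: listed_def clique_algorithm_def clique_outputs_def ident_views)
  {
    fix S assume S: "S \<subseteq> verts (G i)" "finite S" "card S = s"
      "{e. e \<subseteq> S \<and> card e = 2} \<subseteq> edges (G i)"
    \<comment> \<open>Nonemptiness lets an oldest node \<open>v\<close> be chosen as the lister;
      ties are harmless because \<open>known\<close> compares births by \<open>\<le>\<close>. The
      empty clique would have nobody to list it.\<close>
    then have "S \<noteq> {}" using \<open>s \<ge> 1\<close> by auto
    with \<open>finite S\<close> obtain v where v: "v \<in> S" "\<And>u. u \<in> S \<Longrightarrow> ?b v \<le> ?b u"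
      using arg_min_if_finite(1)[of S ?b] arg_min_least[of S _ ?b] by metis
    have nbrs: "S - {v} \<subseteq> nbrs (G i) v"
      using S(4) v(1) by (auto simp: nbrs_def)
    moreover have "e \<in> known ?b (G i) v" if e: "e \<subseteq> S - {v}" "card e = 2" for e
    proof -
      have "e \<noteq> {}" using e by auto
      then obtain x where "x \<in> e" by blast
      with e v have "?b v \<le> ?b x" by blast
      moreover have "e \<in> edges (G i)" using e S(4) by blast
      ultimately show ?thesis using \<open>x \<in> e\<close> e nbrs by (auto simp: known_def)
    qed
    ultimately have "S \<in> listed (clique_algorithm s) G i v"
      using S v(1) listed[of v] by auto
    with v(1) show "\<exists>v\<in>S. S \<in> listed (clique_algorithm s) G i v" by blast
  next
    fix v S assume S: "S \<in> listed (clique_algorithm s) G i v"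
    then have v: "v \<in> verts (G i)" by (auto simp: listed_def split: if_splits)
    from S listed[OF v] have S': "card S = s" "v \<in> S" "S - {v} \<subseteq> nbrs (G i) v"
      "{e. e \<subseteq> S - {v} \<and> card e = 2} \<subseteq> known ?b (G i) v" by auto
    \<comment> \<open>Infinite sets have \<open>card\<close> 0, so positive size forces
      finiteness.\<close>
    have "finite S" using S'(1) \<open>s \<ge> 1\<close> by (intro card_ge_0_finite) simp
    moreover have "S \<subseteq> verts (G i)"
      using S'(3) v wf_graph_nbrsD(2)[OF wf] by blast
    \<comment> \<open>Edges at \<open>v\<close> are certified by its neighbor list, all others by
      its exact knowledge.\<close>
    moreover have "e \<in> edges (G i)" if e: "e \<subseteq> S" "card e = 2" for e
    proof (cases "v \<in> e")
      case True
      with e(2) obtain x where "e = {v, x}" "x \<noteq> v" by (auto simp: card_2_iff)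
      with e(1) S'(3) show ?thesis by (auto simp: nbrs_def)
    next
      case False
      with e S'(4) have "e \<in> known ?b (G i) v" by blast
      then show ?thesis by (simp add: known_def)
    qed
    ultimately show "S \<subseteq> verts (G i) \<and> finite S \<and> card S = s \<and>
        {e. e \<subseteq> S \<and> card e = 2} \<subseteq> edges (G i)"
      using S'(1) by blast
  }
qed

theorem theorem1:
  fixes s c :: nat
  assumes "s \<ge> 1"
  shows "\<exists>b. one_round_bandwidth_at_most c {Node_Insertion, Node_Deletion, Edge_Deletion}
    (List_problem (complete_graph s)) (\<lambda>n. b)"
proof -
  \<comment> \<open>The three flags give the bound, whatever \<open>s\<close> and \<open>c\<close>
    are.\<close>
  have "length (message (clique_algorithm s) G i u v) \<le> 3" for G i u v
    by (simp add: message_def round_messages_def clique_algorithm_def flags_def)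
  then show ?thesis
    unfolding one_round_bandwidth_at_most_def
    using clique_algorithm_correct assms by (meson Suc_leI)
qed

end
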